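(* The $\mathrm{SL}_2(\mathbb{R})$ transformations map normalised semi-quadratic Weingarten relations to normalised semi-quadratic Weingarten relations. If the initial relation has coefficients $\alpha,\beta,\gamma,\delta\in\mathbb{R}$ and the transformation is given by $\begin{pmatrix}a&b\\c&d\end{pmatrix}\in\mathrm{SL}_2(\mathbb{R})$, the coefficients of the target relation $\alpha'k_1k_2+\beta'k_1+\gamma'k_2+\delta'=0$ are given by $$\alpha'=\alpha d^2+\delta b^2+(\beta+\gamma)bd,$$ $$\beta'=\alpha cd+\delta ab+(\beta+\gamma)bc+\beta,$$ $$\gamma'=\alpha cd+\delta ab+(\beta+\gamma)bc+\gamma,$$ $$\delta'=\alpha c^2+\delta a^2+(\beta+\gamma)ac.$$ Furthermore $\Lambda_1^2$ is an invariant, i.e. $(\beta'-\gamma')^2=(\beta-\gamma)^2$.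
   Context: A semi-quadratic Weingarten relation is an equation $\alpha k_1k_2+\beta k_1+\gamma k_2+\delta=0$ with $\alpha,\beta,\gamma,\delta\in\mathbb{R}$ in the principal curvatures $k_1,k_2$. Put $\Lambda_1=\beta-\gamma$ and $\Lambda_2=(\beta+\gamma)^2-4\alpha\delta$; the relation is normalised if $\Lambda_2=1$. The transformation given by $\begin{pmatrix}a&b\\c&d\end{pmatrix}\in\mathrm{SL}_2(\mathbb{R})$ acts on relations by substituting $k_i\mapsto\frac{c+dk_i}{a+bk_i}$, $i=1,2$, into the initial relation and multiplying through by the denominators. *)

theory Defs
  imports "HOL-Analysis.Analysis"
begin

text \<open>
  A relation is identified with its tuple of coefficients, not with its solution set: rescaling
  an equation leaves the solutions unchanged but changes \<open>\<Lambda>\<^sub>1\<close> and \<open>\<Lambda>\<^sub>2\<close>.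
\<close>

datatype sqw_relation =
  SQW (alpha: real) (beta: real) (gamma: real) (delta: real)

definition sqw_lhs :: "sqw_relation \<Rightarrow> real \<Rightarrow> real \<Rightarrow> real" where
  "sqw_lhs R k1 k2 = alpha R * k1 * k2 + beta R * k1 + gamma R * k2 + delta R"

definition Lambda1 :: "sqw_relation \<Rightarrow> real" where
  "Lambda1 R = beta R - gamma R"

definition Lambda2 :: "sqw_relation \<Rightarrow> real" where
  "Lambda2 R = (beta R + gamma R)^2 - 4 * alpha R * delta R"

definition normalised :: "sqw_relation \<Rightarrow> bool" where
  "normalised R \<longleftrightarrow> Lambda2 R = 1"

definition SL2 :: "(real^2^2) set" where
  "SL2 = {A. det A = 1}"

definition moebius_num :: "real^2^2 \<Rightarrow> real \<Rightarrow> real" where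
  "moebius_num A k = A $ 2 $ 1 + A $ 2 $ 2 * k"

definition moebius_den :: "real^2^2 \<Rightarrow> real \<Rightarrow> real" where
  "moebius_den A k = A $ 1 $ 1 + A $ 1 $ 2 * k"

text \<open>
  \<open>R'\<close> arises from \<open>R\<close> by the substitution \<open>k\<^sub>i \<mapsto> (c + d k\<^sub>i) / (a + b k\<^sub>i)\<close>, followed by
  multiplication with both denominators. The identity is required wherever the substitution is
  defined.
\<close>

definition is_target :: "real^2^2 \<Rightarrow> sqw_relation \<Rightarrow> sqw_relation \<Rightarrow> bool" where
  "is_target A R R' \<longleftrightarrow>
     (\<forall>k1 k2. moebius_den A k1 \<noteq> 0 \<longrightarrow> moebius_den A k2 \<noteq> 0 \<longrightarrow>
        sqw_lhs R' k1 k2 =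
          moebius_den A k1 * moebius_den A k2 *
          sqw_lhs R (moebius_num A k1 / moebius_den A k1) (moebius_num A k2 / moebius_den A k2))"

definition sl2_transform :: "real^2^2 \<Rightarrow> sqw_relation \<Rightarrow> sqw_relation" where
  "sl2_transform A R = (THE R'. is_target A R R')"

end

theory Submission
  imports Defs
begin

text \<open>
  Clearing denominators yields another bilinear polynomial, whose coefficients are read off, and a
  bilinear polynomial is determined by its values on a grid \<open>{x, y} \<times> {x, y}\<close> with \<open>x \<noteq> y\<close> on which
  the denominators do not vanish. \<open>\<Lambda>\<^sub>2\<close> is the discriminant of the binary quadratic form
  \<open>\<alpha> u\<^sup>2 + (\<beta> + \<gamma>) u v + \<delta> v\<^sup>2\<close>, on which the transformation acts by a linear change of variables
  of determinant 1.
\<close>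

lemma sqw_relation_eqI:
  assumes "x \<noteq> y"
    and eq: "\<And>k1 k2. k1 \<in> {x, y} \<Longrightarrow> k2 \<in> {x, y} \<Longrightarrow> sqw_lhs R k1 k2 = sqw_lhs S k1 k2"
  shows "R = S"
proof -
  define p q r s where "p = alpha R - alpha S" and "q = beta R - beta S"
    and "r = gamma R - gamma S" and "s = delta R - delta S"
  have grid: "p * k1 * k2 + q * k1 + r * k2 + s = 0" if "k1 \<in> {x, y}" "k2 \<in> {x, y}" for k1 k2
    using eq[OF that] by (simp add: sqw_lhs_def p_def q_def r_def s_def algebra_simps)
  note g = grid[of x x, simplified] grid[of x y, simplified]
    grid[of y x, simplified] grid[of y y, simplified]
  \<comment> \<open>The alternating sum of the four grid equations, a second mixed difference,
    cancels \<open>q\<close>, \<open>r\<close> and \<open>s\<close>.\<close>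
  have "p * (x - y) * (x - y) = 0"
    using g by (simp add: algebra_simps)
  then have p: "p = 0"
    using \<open>x \<noteq> y\<close> by simp
  have "q * x = q * y" "r * x = r * y"
    using g unfolding p by linarith+
  then have "q = 0" "r = 0"
    using \<open>x \<noteq> y\<close> by simp_all
  with p g have "s = 0"
    by simp
  with p \<open>q = 0\<close> \<open>r = 0\<close> show ?thesis
    by (intro sqw_relation.expand) (simp add: p_def q_def r_def s_def)
qed

lemma ex_two_nonzeros_affine:
  fixes a b :: real
  assumes "a \<noteq> 0 \<or> b \<noteq> 0"
  obtains x y where "x \<noteq> y" "a + b * x \<noteq> 0" "a + b * y \<noteq> 0"
proof (cases "b = 0")
  case True
  with assms show ?thesis
    using that[of 0 1] by simp
next
  case False
  then show ?thesis
    \<comment> \<open>The witnesses are the points at which the affine function takes the values 1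
      and 2.\<close>
    using that[of "(1 - a) / b" "(2 - a) / b"] by (simp add: field_simps)
qed

text \<open>If the first row vanished, both denominators would be identically zero and every
  relation would be a target vacuously.\<close>

lemma is_target_unique:
  assumes "A $ 1 $ 1 \<noteq> 0 \<or> A $ 1 $ 2 \<noteq> 0" "is_target A R S" "is_target A R S'"
  shows "S = S'"
proof -
  obtain x y where "x \<noteq> y" "moebius_den A x \<noteq> 0" "moebius_den A y \<noteq> 0"
    using ex_two_nonzeros_affine[OF assms(1)] unfolding moebius_den_def by metis
  then show ?thesis
    using assms(2,3) by (intro sqw_relation_eqI[of x y]) (auto simp: is_target_def)
qed

text \<open>The products \<open>a * d\<close> and \<open>b * c\<close> are kept apart, without using
  determinant 1, so that the formula is the target for every matrix and powers of
  \<open>det A\<close> show up as explicit factors.\<close>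

definition sqw_image :: "real^2^2 \<Rightarrow> sqw_relation \<Rightarrow> sqw_relation" where
  "sqw_image A R =
    (let a = A $ 1 $ 1; b = A $ 1 $ 2; c = A $ 2 $ 1; d = A $ 2 $ 2
     in SQW (alpha R * d^2 + delta R * b^2 + (beta R + gamma R) * b * d)
       (alpha R * c * d + delta R * a * b + beta R * a * d + gamma R * b * c)
       (alpha R * c * d + delta R * a * b + beta R * b * c + gamma R * a * d)
       (alpha R * c^2 + delta R * a^2 + (beta R + gamma R) * a * c))"

lemma is_target_sqw_image: "is_target A R (sqw_image A R)"
proof -
  have clear: "m * n * sqw_lhs R (u / m) (v / n)
      = alpha R * u * v + beta R * u * n + gamma R * m * v + delta R * m * n"
    if "m \<noteq> 0" "n \<noteq> 0" for m n u v
    using that by (simp add: sqw_lhs_def field_simps)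
  show ?thesis
    by (simp add: is_target_def clear)
      (simp add: sqw_lhs_def sqw_image_def moebius_num_def moebius_den_def Let_def
        algebra_simps power2_eq_square)
qed

text \<open>The terms in \<alpha> and \<delta> are common to both linear coefficients and cancel in
  the difference, which leaves the factor \<open>a * d - b * c\<close>.\<close>

lemma Lambda1_sqw_image: "Lambda1 (sqw_image A R) = det A * Lambda1 R"
  by (simp add: Lambda1_def sqw_image_def det_2 Let_def algebra_simps)

lemma Lambda2_sqw_image: "Lambda2 (sqw_image A R) = (det A)^2 * Lambda2 R"
  by (simp add: Lambda2_def sqw_image_def det_2 Let_def algebra_simps power2_eq_square)

lemma SL2_row_nonzero: "A \<in> SL2 \<Longrightarrow> A $ 1 $ 1 \<noteq> 0 \<or> A $ 1 $ 2 \<noteq> 0"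
  by (auto simp: SL2_def det_2)

lemma ex1_is_target: "A \<in> SL2 \<Longrightarrow> \<exists>!S. is_target A R S"
  using is_target_sqw_image is_target_unique SL2_row_nonzero by metis

lemma sl2_transform_eq: "A \<in> SL2 \<Longrightarrow> sl2_transform A R = sqw_image A R"
  unfolding sl2_transform_def
  by (rule the1_equality[OF ex1_is_target is_target_sqw_image])

theorem proposition4p21:
  fixes \<alpha> \<beta> \<gamma> \<delta> a b c d :: real and A :: "real^2^2" and R :: sqw_relation
  assumes A: "A = vector [vector [a, b], vector [c, d]]" "A \<in> SL2"
    and R: "R = SQW \<alpha> \<beta> \<gamma> \<delta>"
  shows "(\<exists>!R'. is_target A R R')
    \<and> (normalised R \<longrightarrow> normalised (sl2_transform A R))
    \<and> alpha (sl2_transform A R) = \<alpha> * d^2 + \<delta> * b^2 + (\<beta> + \<gamma>) * b * d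
    \<and> beta (sl2_transform A R) = \<alpha> * c * d + \<delta> * a * b + (\<beta> + \<gamma>) * b * c + \<beta>
    \<and> gamma (sl2_transform A R) = \<alpha> * c * d + \<delta> * a * b + (\<beta> + \<gamma>) * b * c + \<gamma>
    \<and> delta (sl2_transform A R) = \<alpha> * c^2 + \<delta> * a^2 + (\<beta> + \<gamma>) * a * c
    \<and> (Lambda1 (sl2_transform A R))^2 = (Lambda1 R)^2"
proof -
  have det: "det A = 1"
    using A(2) by (simp add: SL2_def)
  then have ad: "a * d = 1 + b * c"
    by (simp add: A(1) det_2)
  \<comment> \<open>Replacing \<open>a * d\<close> by \<open>1 + b * c\<close> splits off the lone
    summands \<beta> and \<gamma> of the claimed linear coefficients.\<close>
  have "\<beta> * a * d = \<beta> * (1 + b * c)" "\<gamma> * a * d = \<gamma> * (1 + b * c)"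
    by (simp_all add: ad[symmetric])
  moreover have "sqw_image A R = SQW (\<alpha> * d^2 + \<delta> * b^2 + (\<beta> + \<gamma>) * b * d)
      (\<alpha> * c * d + \<delta> * a * b + \<beta> * a * d + \<gamma> * b * c)
      (\<alpha> * c * d + \<delta> * a * b + \<beta> * b * c + \<gamma> * a * d)
      (\<alpha> * c^2 + \<delta> * a^2 + (\<beta> + \<gamma>) * a * c)"
    by (simp add: sqw_image_def A(1) R)
  moreover have "normalised (sqw_image A R) \<longleftrightarrow> normalised R"
    by (simp add: normalised_def Lambda2_sqw_image det)
  moreover have "Lambda1 (sqw_image A R) = Lambda1 R"
    by (simp add: Lambda1_sqw_image det)
  ultimately show ?thesis
    using ex1_is_target[OF A(2)] by (simp add: sl2_transform_eq[OF A(2)] algebra_simps)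
qed

end
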